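(* Let $C\in\mathcal C_1^\star$ be a cluster containing at least two atoms, where $\mathcal C_1^\star$ is a regular atom-respecting clustering. For every atom $A\subseteq C$, $$\|\delta_AP_C-\pi_C\|_{\pi_C^{-1}}^2\le31,$$ where $\delta_A$ is the point mass at $A$, viewed as a row vector indexed by the atoms contained in $C$.
   Context: Instance: a set $V$ of $n\ge2$ vertices; $\binom V2=E^+\uplus E^-$ (positive/negative pairs, arbitrary); weights $w_{uv}=w_{vu}\ge0$, $w_{uu}=0$, $w_{uv}\le w_{ua}+w_{av}$ for all $u,v,a\in V$. For a partition (clustering) $\mathcal C$ of $V$, $\operatorname{obj}(\mathcal C)$ is the total weight of positive pairs whose endpoints lie in different parts plus the total weight of negative pairs whose endpoints lie in the same part; $\mathrm{OPT}=\min_{\mathcal C}\operatorname{obj}(\mathcal C)$. For $A,B\subseteq V$, $w(A,B)=\sum_{a\in A}\sum_{b\in B}w_{ab}$; $w^+(A,B)$ is the same sum restricted to positive pairs; $w(u,A)=w(\{u\},A)$. $N_u^+=\{v\ne u:uv\in E^+\}$. Atoms. Fix an absolute constant $\beta$ with $0<\beta\le\frac{2\sqrt7-5}{6}$ and a clustering $\mathcal C^0$ with $\operatorname{obj}(\mathcal C^0)\le\frac{20}3\mathrm{OPT}$. For $u\in C\in\mathcal C^0$ put $\mathrm{dis}_C(u)=w(u,N_u^+\triangle C)$ and $M_C=\{u\in C:\mathrm{dis}_C(u)>\frac\beta2w(u,C)\}$. The atom partition $\mathcal K$ is obtained by processing each $C\in\mathcal C^0$: if $\sum_{u\in M_C}\mathrm{dis}_C(u)>\frac{\beta^2}{20}w(C,C)$,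 put every singleton $\{u\}$, $u\in C$, in $\mathcal K$; otherwise put $\{u\}$ in $\mathcal K$ for each $u\in M_C$, and also $C\setminus M_C$ if nonempty. $\alpha\ge1$ is a fixed absolute constant (depending only on $\beta$) such that $\operatorname{obj}(\mathcal K)\le\alpha\,\mathrm{OPT}$ always holds. Regular clustering. Let $\varepsilon\in(0,1]$. For unions $X,Y$ of atoms let $w^+_{\mathcal K}(X,Y)=\sum w^+(K,L)$ over $K,L\in\mathcal K$ with $K\subseteq X$, $L\subseteq Y$, $K\ne L$. $\mathcal C_1^\star$ is a clustering such that each atom is contained in one of its parts (atom-respecting), its cost is at most $(1+\varepsilon)\mathrm{OPT}$, and for each $C\in\mathcal C_1^\star$: (R1) for every partition $S\uplus T=C$ into two nonempty unions of atoms, $w^+(S,T)>\frac12w(S,T)$; (R2) for every atom $K\subsetneq C$, $w^+_{\mathcal K}(K,C)>\frac{\varepsilon}{2\alpha}w^+_{\mathcal K}(K,V)$. Local walk. For $C\in\mathcal C_1^\star$ with at least two atoms let $\mathcal A_C$ be the set of atoms contained in $C$; for $K\in\mathcal A_C$, $d_C(K)=\sum_{L\in\mathcal A_C\setminus\{K\}}w^+(K,L)$ (positive by (R1)); $\mathrm{vol}_C=\sum_{K\in\mathcal A_C}d_C(K)$. $P_C$ is the matrix on $\mathcal A_C$ with $P_C(A,B)=w^+(A,B)/d_C(A)$ for $A\ne B$ and $P_C(A,A)=0$; $\pi_C(A)=d_C(A)/\mathrm{vol}_C$. For a probability vector $q$ on $\mathcal A_C$, $\|q-\pi_C\|_{\pi_C^{-1}}^2=\sum_{A\in\mathcal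 A_C}\frac{(q(A)-\pi_C(A))^2}{\pi_C(A)}$. *)

theory Defs
  imports Complex_Main "HOL-Library.Disjoint_Sets"
begin

record 'a cc_instance =
  verts :: "'a set"
  pos :: "'a set set"
  neg :: "'a set set"
  weight :: "'a \<Rightarrow> 'a \<Rightarrow> real"

definition cc_instance :: "'a cc_instance \<Rightarrow> bool" where
  "cc_instance G \<longleftrightarrow>
     finite (verts G) \<and> 2 \<le> card (verts G) \<and>
     pos G \<union> neg G = {e. e \<subseteq> verts G \<and> card e = 2} \<and> pos G \<inter> neg G = {} \<and>
     (\<forall>u\<in>verts G. \<forall>v\<in>verts G. 0 \<le> weight G u v \<and> weight G u v = weight G v u) \<and>
     (\<forall>u\<in>verts G. weight G u u = 0) \<and>
     (\<forall>u\<in>verts G. \<forall>v\<in>verts G. \<forall>a\<in>verts G.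
        weight G u v \<le> weight G u a + weight G a v)"

abbreviation clustering :: "'a cc_instance \<Rightarrow> 'a set set \<Rightarrow> bool" where
  "clustering G \<C> \<equiv> partition_on (verts G) \<C>"

definition same_part :: "'a set set \<Rightarrow> 'a \<Rightarrow> 'a \<Rightarrow> bool" where
  "same_part \<C> u v \<longleftrightarrow> (\<exists>C\<in>\<C>. u \<in> C \<and> v \<in> C)"

(* The sums run over ordered pairs (u, v), so each unordered pair is counted twice;
   this is the reason for the division by 2. *)
definition obj :: "'a cc_instance \<Rightarrow> 'a set set \<Rightarrow> real" where
  "obj G \<C> =
     ((\<Sum>(u, v) | u \<in> verts G \<and> v \<in> verts G \<and> {u, v} \<in> pos G \<and> \<not> same_part \<C> u v. weight G u v)
    + (\<Sum>(u, v) | u \<in> verts G \<and> v \<in> verts G \<and> {u, v} \<in> neg G \<and> same_part \<C> u v. weight G u v)) / 2"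

definition OPT :: "'a cc_instance \<Rightarrow> real" where
  "OPT G = Min (obj G ` {\<C>. clustering G \<C>})"

definition wt :: "'a cc_instance \<Rightarrow> 'a set \<Rightarrow> 'a set \<Rightarrow> real" where
  "wt G A B = (\<Sum>a\<in>A. \<Sum>b\<in>B. weight G a b)"

definition wt_pos :: "'a cc_instance \<Rightarrow> 'a set \<Rightarrow> 'a set \<Rightarrow> real" where
  "wt_pos G A B = (\<Sum>a\<in>A. \<Sum>b\<in>B. if {a, b} \<in> pos G then weight G a b else 0)"

definition nbrs_pos :: "'a cc_instance \<Rightarrow> 'a \<Rightarrow> 'a set" where
  "nbrs_pos G u = {v. v \<noteq> u \<and> {u, v} \<in> pos G}"

definition dis :: "'a cc_instance \<Rightarrow> 'a set \<Rightarrow> 'a \<Rightarrow> real" where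
  "dis G C u = wt G {u} ((nbrs_pos G u - C) \<union> (C - nbrs_pos G u))"

definition marked :: "'a cc_instance \<Rightarrow> real \<Rightarrow> 'a set \<Rightarrow> 'a set" where
  "marked G \<beta> C = {u \<in> C. dis G C u > \<beta> / 2 * wt G {u} C}"

definition split_cluster :: "'a cc_instance \<Rightarrow> real \<Rightarrow> 'a set \<Rightarrow> 'a set set" where
  "split_cluster G \<beta> C =
     (if (\<Sum>u\<in>marked G \<beta> C. dis G C u) > \<beta>\<^sup>2 / 20 * wt G C C
      then (\<lambda>u. {u}) ` C
      else (\<lambda>u. {u}) ` marked G \<beta> C \<union>
           (if C - marked G \<beta> C \<noteq> {} then {C - marked G \<beta> C} else {}))"

definition atom_partition :: "'a cc_instance \<Rightarrow> real \<Rightarrow> 'a set set \<Rightarrow> 'a set set" where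
  "atom_partition G \<beta> \<C>0 = (\<Union>C\<in>\<C>0. split_cluster G \<beta> C)"

definition base_clustering :: "'a cc_instance \<Rightarrow> 'a set set \<Rightarrow> bool" where
  "base_clustering G \<C>0 \<longleftrightarrow> clustering G \<C>0 \<and> obj G \<C>0 \<le> 20 / 3 * OPT G"

(* The factor \<alpha> is absolute: it is required to work for all instances (with vertices in the
   given type) and all admissible base clusterings simultaneously, and may depend on \<beta> only. *)
definition atom_factor :: "'a itself \<Rightarrow> real \<Rightarrow> real \<Rightarrow> bool" where
  "atom_factor (_ :: 'a itself) \<beta> \<alpha> \<longleftrightarrow>
     1 \<le> \<alpha> \<and>
     (\<forall>(G :: 'a cc_instance) \<C>0. cc_instance G \<and> base_clustering G \<C>0 \<longrightarrow>
        obj G (atom_partition G \<beta> \<C>0) \<le> \<alpha> * OPT G)"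

definition union_of_atoms :: "'a set set \<Rightarrow> 'a set \<Rightarrow> bool" where
  "union_of_atoms \<K> X \<longleftrightarrow> (\<exists>\<S>\<subseteq>\<K>. X = \<Union>\<S>)"

definition wt_pos_atoms :: "'a cc_instance \<Rightarrow> 'a set set \<Rightarrow> 'a set \<Rightarrow> 'a set \<Rightarrow> real" where
  "wt_pos_atoms G \<K> X Y =
     (\<Sum>(K, L) | K \<in> \<K> \<and> L \<in> \<K> \<and> K \<subseteq> X \<and> L \<subseteq> Y \<and> K \<noteq> L. wt_pos G K L)"

definition regular_clustering ::
  "'a cc_instance \<Rightarrow> 'a set set \<Rightarrow> real \<Rightarrow> real \<Rightarrow> 'a set set \<Rightarrow> bool" where
  "regular_clustering G \<K> \<alpha> \<epsilon> \<C> \<longleftrightarrow>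
     clustering G \<C> \<and>
     (\<forall>K\<in>\<K>. \<exists>C\<in>\<C>. K \<subseteq> C) \<and>
     obj G \<C> \<le> (1 + \<epsilon>) * OPT G \<and>
     (\<forall>C\<in>\<C>.
        (\<forall>S T. union_of_atoms \<K> S \<and> union_of_atoms \<K> T \<and> S \<noteq> {} \<and> T \<noteq> {} \<and>
               S \<union> T = C \<and> S \<inter> T = {} \<longrightarrow> wt_pos G S T > 1 / 2 * wt G S T) \<and>
        (\<forall>K\<in>\<K>. K \<subset> C \<longrightarrow>
               wt_pos_atoms G \<K> K C > \<epsilon> / (2 * \<alpha>) * wt_pos_atoms G \<K> K (verts G)))"

definition atoms_in :: "'a set set \<Rightarrow> 'a set \<Rightarrow> 'a set set" where
  "atoms_in \<K> C = {K \<in> \<K>. K \<subseteq> C}"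

definition atom_deg :: "'a cc_instance \<Rightarrow> 'a set set \<Rightarrow> 'a set \<Rightarrow> 'a set \<Rightarrow> real" where
  "atom_deg G \<K> C K = (\<Sum>L\<in>atoms_in \<K> C - {K}. wt_pos G K L)"

definition vol :: "'a cc_instance \<Rightarrow> 'a set set \<Rightarrow> 'a set \<Rightarrow> real" where
  "vol G \<K> C = (\<Sum>K\<in>atoms_in \<K> C. atom_deg G \<K> C K)"

definition walk_matrix ::
  "'a cc_instance \<Rightarrow> 'a set set \<Rightarrow> 'a set \<Rightarrow> 'a set \<Rightarrow> 'a set \<Rightarrow> real" where
  "walk_matrix G \<K> C A B = (if A = B then 0 else wt_pos G A B / atom_deg G \<K> C A)"

definition stationary :: "'a cc_instance \<Rightarrow> 'a set set \<Rightarrow> 'a set \<Rightarrow> 'a set \<Rightarrow> real" where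
  "stationary G \<K> C A = atom_deg G \<K> C A / vol G \<K> C"

definition point_mass :: "'b \<Rightarrow> 'b \<Rightarrow> real" where
  "point_mass a b = (if b = a then 1 else 0)"

definition row_mult :: "'b set \<Rightarrow> ('b \<Rightarrow> real) \<Rightarrow> ('b \<Rightarrow> 'b \<Rightarrow> real) \<Rightarrow> 'b \<Rightarrow> real" where
  "row_mult I q P j = (\<Sum>i\<in>I. q i * P i j)"

definition inv_weighted_norm_sq :: "'b set \<Rightarrow> ('b \<Rightarrow> real) \<Rightarrow> ('b \<Rightarrow> real) \<Rightarrow> real" where
  "inv_weighted_norm_sq I \<pi> x = (\<Sum>i\<in>I. (x i)\<^sup>2 / \<pi> i)"

end

theory Submission
  imports Defs
begin

text \<open>
  By (R1) with $S = K$, at least half of the weight leaving an atom $K$ inside $C$ is positive. Let $D(K)$ be the weight leaving $K$ inside $C$, and let $V$ be the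
  sum of all $D(K)$. Averaging the triangle inequality over the vertices of atoms gives
  $w(K,L)\,|X| \le |L|\,w(K,X) + |K|\,w(X,L)$. Summing over $X$ yields
  $|C|\,w(K,L) \le |L|\,D(K) + |K|\,D(L)$, and summing over $K, L$ yields
  $V\,|X| \le 2\,|C|\,D(X)$. Together, $V\,w(A,B) \le 4\,D(A)\,D(B)$, hence
  $P_C(A,B) \le 16\,\pi_C(B)$, and the squared norm is at most
  $\sum_B P_C(A,B)^2 / \pi_C(B) - 1 \le 15$.
\<close>

section \<open>Two inequalities over finite index sets\<close>

lemma chi_square_le:
  fixes x \<pi> :: "'b \<Rightarrow> real"
  assumes "finite I"
    and x: "\<And>i. i \<in> I \<Longrightarrow> 0 \<le> x i" "sum x I = 1"
    and \<pi>: "\<And>i. i \<in> I \<Longrightarrow> 0 < \<pi> i" "sum \<pi> I = 1"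
    and le: "\<And>i. i \<in> I \<Longrightarrow> x i \<le> c * \<pi> i"
  shows "inv_weighted_norm_sq I \<pi> (\<lambda>i. x i - \<pi> i) \<le> c - 1"
proof -
  \<comment> \<open>Expanding the square gives
    \<open>(x i)\<^sup>2 / \<pi> i - 2 * x i + \<pi> i\<close>, whose first term is at most
    \<open>c * x i\<close>. As both totals are 1, summation yields c - 2 + 1.\<close>
  have "(x i - \<pi> i)\<^sup>2 / \<pi> i \<le> c * x i - 2 * x i + \<pi> i" if "i \<in> I" for i
  proof -
    have "x i * x i \<le> x i * (c * \<pi> i)"
      using le x(1) that by (intro mult_left_mono) auto
    then have "(x i - \<pi> i)\<^sup>2 \<le> (c * x i - 2 * x i + \<pi> i) * \<pi> i"
      by (simp add: power2_eq_square algebra_simps)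
    then show ?thesis
      using \<pi>(1) that by (simp add: pos_divide_le_eq)
  qed
  then have "inv_weighted_norm_sq I \<pi> (\<lambda>i. x i - \<pi> i) \<le> (\<Sum>i\<in>I. c * x i - 2 * x i + \<pi> i)"
    unfolding inv_weighted_norm_sq_def by (rule sum_mono)
  also have "\<dots> = c * sum x I - 2 * sum x I + sum \<pi> I"
    by (simp add: sum.distrib sum_subtractf sum_distrib_left)
  finally show ?thesis
    using x(2) \<pi>(2) by simp
qed

text \<open>The inequality assumed on \<open>W\<close> is the triangle inequality for the mean distances
  \<open>W K L / (s K * s L)\<close> between groups of sizes \<open>s\<close>.\<close>

lemma weighted_triangle_product_bound:
  fixes W :: "'b \<Rightarrow> 'b \<Rightarrow> real" and s :: "'b \<Rightarrow> real"
  assumes "finite I"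
    and s: "\<And>K. K \<in> I \<Longrightarrow> 0 < s K"
    and nonneg: "\<And>K L. K \<in> I \<Longrightarrow> L \<in> I \<Longrightarrow> 0 \<le> W K L"
    and sym: "\<And>K L. K \<in> I \<Longrightarrow> L \<in> I \<Longrightarrow> W K L = W L K"
    and tri: "\<And>K L X. K \<in> I \<Longrightarrow> L \<in> I \<Longrightarrow> X \<in> I \<Longrightarrow> W K L * s X \<le> s L * W K X + s K * W X L"
    and A: "A \<in> I" and B: "B \<in> I"
  defines "D \<equiv> \<lambda>K. \<Sum>L\<in>I. W K L"
  shows "(\<Sum>K\<in>I. D K) * W A B \<le> 4 * D A * D B"
proof -
  let ?V = "\<Sum>K\<in>I. D K"
  define n where "n = (\<Sum>K\<in>I. s K)"
  have n: "0 < n"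
    unfolding n_def using assms(1) A s by (intro sum_pos) auto
  have D: "0 \<le> D K" if "K \<in> I" for K
    unfolding D_def using nonneg that by (intro sum_nonneg) auto
  \<comment> \<open>The inequality \<open>tri\<close> also produces column sums; symmetry turns them
    into row sums.\<close>
  have D': "(\<Sum>X\<in>I. W X K) = D K" if "K \<in> I" for K
    unfolding D_def using sym that by (intro sum.cong) auto
  have "W A B * n = (\<Sum>X\<in>I. W A B * s X)"
    by (simp add: n_def sum_distrib_left)
  also have "\<dots> \<le> (\<Sum>X\<in>I. s B * W A X + s A * W X B)"
    using tri A B by (intro sum_mono) auto
  also have "\<dots> = s B * D A + s A * D B"
    using D'[OF B] by (simp add: sum.distrib D_def flip: sum_distrib_left)
  finally have AB: "W A B * n \<le> s B * D A + s A * D B" .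
  \<comment> \<open>Here the intermediate group \<open>X\<close> stays fixed while both endpoints
    vary; each of the two terms on the right of \<open>tri\<close> contributes
    \<open>n * D X\<close>.\<close>
  have V: "?V * s X \<le> 2 * n * D X" if X: "X \<in> I" for X
  proof -
    have "?V * s X = (\<Sum>K\<in>I. \<Sum>L\<in>I. W K L * s X)"
      by (simp add: D_def sum_distrib_right)
    also have "\<dots> \<le> (\<Sum>K\<in>I. \<Sum>L\<in>I. s L * W K X + s K * W X L)"
      using tri X by (intro sum_mono) auto
    also have "\<dots> = (\<Sum>K\<in>I. n * W K X + s K * D X)"
      by (simp add: sum.distrib D_def n_def sum_distrib_right flip: sum_distrib_left)
    also have "\<dots> = n * (\<Sum>K\<in>I. W K X) + n * D X"
      by (simp add: sum.distrib n_def flip: sum_distrib_left sum_distrib_right)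
    finally show ?thesis
      using D'[OF X] by simp
  qed
  \<comment> \<open>Multiplying \<open>AB\<close> by \<open>?V\<close> allows \<open>V\<close> to
    trade the sizes \<open>s A\<close> and \<open>s B\<close> for multiples of \<open>n\<close>.
    Each summand becomes \<open>2 * n * D A * D B\<close>, whence the factor 4, and \<open>n\<close>
    cancels.\<close>
  have "(?V * W A B) * n = ?V * (W A B * n)"
    by simp
  also have "\<dots> \<le> ?V * (s B * D A + s A * D B)"
    using AB D by (intro mult_left_mono sum_nonneg) auto
  also have "\<dots> = (?V * s B) * D A + (?V * s A) * D B"
    by (simp add: algebra_simps)
  also have "\<dots> \<le> (2 * n * D B) * D A + (2 * n * D A) * D B"
    using V A B D by (intro add_mono mult_right_mono) auto
  finally have "(?V * W A B) * n \<le> (4 * D A * D B) * n"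
    by (simp add: algebra_simps)
  then show ?thesis
    using n by simp
qed

section \<open>Weights between vertex sets\<close>

lemma weight_nonneg:
  assumes "cc_instance G" "u \<in> verts G" "v \<in> verts G"
  shows "0 \<le> weight G u v"
  using assms unfolding cc_instance_def by blast

lemma wt_nonneg:
  assumes "cc_instance G" "K \<subseteq> verts G" "L \<subseteq> verts G"
  shows "0 \<le> wt G K L"
  using assms unfolding wt_def by (intro sum_nonneg weight_nonneg) auto

lemma wt_commute:
  assumes "cc_instance G" "K \<subseteq> verts G" "L \<subseteq> verts G"
  shows "wt G K L = wt G L K"
proof -
  have "wt G K L = (\<Sum>a\<in>K. \<Sum>b\<in>L. weight G b a)"
    unfolding wt_def using assms unfolding cc_instance_def
    by (intro sum.cong refl) blast
  also have "\<dots> = wt G L K"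
    unfolding wt_def by (rule sum.swap)
  finally show ?thesis .
qed

text \<open>Sum the triangle inequality over all triples (a, b, x): each term is repeated once for
  every choice of the vertex it does not mention.\<close>

lemma wt_triangle:
  assumes "cc_instance G" "K \<subseteq> verts G" "L \<subseteq> verts G" "X \<subseteq> verts G"
  shows "wt G K L * card X \<le> card L * wt G K X + card K * wt G X L"
proof -
  have "wt G K L * card X = (\<Sum>a\<in>K. \<Sum>b\<in>L. \<Sum>x\<in>X. weight G a b)"
    by (simp add: wt_def sum_distrib_left mult.commute)
  also have "\<dots> \<le> (\<Sum>a\<in>K. \<Sum>b\<in>L. \<Sum>x\<in>X. weight G a x + weight G x b)"
    using assms unfolding cc_instance_def by (intro sum_mono) blast
  also have "\<dots> = (\<Sum>a\<in>K. card L * (\<Sum>x\<in>X. weight G a x)) + card K * (\<Sum>b\<in>L. \<Sum>x\<in>X. weight G x b)"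
    by (simp add: sum.distrib)
  also have "(\<Sum>b\<in>L. \<Sum>x\<in>X. weight G x b) = wt G X L"
    unfolding wt_def by (rule sum.swap)
  finally show ?thesis
    by (simp add: wt_def sum_distrib_left)
qed

lemma wt_pos_nonneg:
  assumes "cc_instance G" "K \<subseteq> verts G" "L \<subseteq> verts G"
  shows "0 \<le> wt_pos G K L"
  using assms unfolding wt_pos_def by (intro sum_nonneg) (auto intro: weight_nonneg)

lemma wt_pos_le_wt:
  assumes "cc_instance G" "K \<subseteq> verts G" "L \<subseteq> verts G"
  shows "wt_pos G K L \<le> wt G K L"
  using assms unfolding wt_pos_def wt_def by (intro sum_mono) (auto intro: weight_nonneg)

text \<open>(R1) speaks of unions of atoms, \<open>atom_deg\<close> of single atoms; this additivity
  translates between the two.\<close>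

lemma
  assumes "finite \<L>" "\<And>L. L \<in> \<L> \<Longrightarrow> finite L" "disjoint \<L>"
  shows wt_Union_right: "wt G K (\<Union>\<L>) = (\<Sum>L\<in>\<L>. wt G K L)"
    and wt_pos_Union_right: "wt_pos G K (\<Union>\<L>) = (\<Sum>L\<in>\<L>. wt_pos G K L)"
proof -
  have split: "sum f (\<Union>\<L>) = (\<Sum>L\<in>\<L>. sum f L)" for f :: "'a \<Rightarrow> real"
    using sum.Union_disjoint[of \<L> f] assms by (auto simp: disjoint_def)
  show "wt G K (\<Union>\<L>) = (\<Sum>L\<in>\<L>. wt G K L)"
    unfolding wt_def split by (rule sum.swap)
  show "wt_pos G K (\<Union>\<L>) = (\<Sum>L\<in>\<L>. wt_pos G K L)"
    unfolding wt_pos_def split by (rule sum.swap)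
qed

section \<open>Atoms as a partition, and how they fill the clusters\<close>

lemma partition_on_split_cluster:
  assumes "C \<noteq> {}"
  shows "partition_on C (split_cluster G \<beta> C)"
proof -
  have "marked G \<beta> C \<subseteq> C"
    by (auto simp: marked_def)
  then show ?thesis
    unfolding partition_on_def split_cluster_def disjoint_def by auto
qed

lemma partition_on_atom_partition:
  assumes "clustering G \<C>"
  shows "partition_on (verts G) (atom_partition G \<beta> \<C>)"
proof (rule partition_onI)
  have part: "partition_on C (split_cluster G \<beta> C)" if "C \<in> \<C>" for C
    using that assms partition_onD3 by (metis partition_on_split_cluster)
  have "\<Union>(atom_partition G \<beta> \<C>) = (\<Union>C\<in>\<C>. \<Union>(split_cluster G \<beta> C))"
    unfolding atom_partition_def by blast
  also have "\<dots> = (\<Union>C\<in>\<C>. C)"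
    using partition_onD1[OF part] by (intro SUP_cong) auto
  finally show "\<Union>(atom_partition G \<beta> \<C>) = verts G"
    using partition_onD1[OF assms] by simp
  show "{} \<notin> atom_partition G \<beta> \<C>"
    using partition_onD3[OF part] unfolding atom_partition_def by auto
  show "disjnt K L"
    if KL: "K \<in> atom_partition G \<beta> \<C>" "L \<in> atom_partition G \<beta> \<C>" "K \<noteq> L" for K L
  proof -
    obtain C C' where C: "C \<in> \<C>" "K \<in> split_cluster G \<beta> C"
      and C': "C' \<in> \<C>" "L \<in> split_cluster G \<beta> C'"
      using KL unfolding atom_partition_def by auto
    show ?thesis
    \<comment> \<open>Atoms of one cluster are disjoint because splitting partitions it; atoms of
      different clusters inherit disjointness from the clusters.\<close>
    proof (cases "C = C'")
      case True
      then show ?thesis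
        using partition_onD2[OF part[OF C(1)]] C(2) C'(2) KL(3) by (auto simp: disjoint_def disjnt_def)
    next
      case False
      then have "C \<inter> C' = {}"
        using partition_onD2[OF assms] C(1) C'(1) by (auto simp: disjoint_def)
      moreover have "K \<subseteq> C" "L \<subseteq> C'"
        using partition_onD1[OF part] C C' by blast+
      ultimately show ?thesis
        by (auto simp: disjnt_def)
    qed
  qed
qed

text \<open>The atom through a point of \<open>C\<close> lies in some part, and that part meets
  \<open>C\<close> in this point, so it is \<open>C\<close>.\<close>

lemma Union_atoms_in:
  assumes "partition_on V \<K>" "partition_on V \<C>"
    and resp: "\<forall>K\<in>\<K>. \<exists>C\<in>\<C>. K \<subseteq> C" and "C \<in> \<C>"
  shows "\<Union>(atoms_in \<K> C) = C"
proof
  show "\<Union>(atoms_in \<K> C) \<subseteq> C"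
    by (auto simp: atoms_in_def)
  show "C \<subseteq> \<Union>(atoms_in \<K> C)"
  proof
    fix v assume v: "v \<in> C"
    then obtain K where K: "K \<in> \<K>" "v \<in> K"
      using assms(4) partition_onD1[OF assms(1)] partition_onD1[OF assms(2)] by blast
    then obtain C' where C': "C' \<in> \<C>" "K \<subseteq> C'"
      using resp by blast
    then have "C' = C"
      using v K assms(4) partition_onD2[OF assms(2)] by (auto simp: disjoint_def)
    then show "v \<in> \<Union>(atoms_in \<K> C)"
      using K C' by (auto simp: atoms_in_def)
  qed
qed

theorem claim3p8:
  fixes G :: "'a cc_instance"
    and \<alpha> \<beta> \<epsilon> :: real
    and \<C>0 \<K> \<C>1 :: "'a set set"
    and C A :: "'a set"
  assumes "cc_instance G"
    and "0 < \<beta>" and "\<beta> \<le> (2 * sqrt 7 - 5) / 6"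
    and "base_clustering G \<C>0"
    and "\<K> = atom_partition G \<beta> \<C>0"
    and "atom_factor TYPE('a) \<beta> \<alpha>"
    and "0 < \<epsilon>" and "\<epsilon> \<le> 1"
    and "regular_clustering G \<K> \<alpha> \<epsilon> \<C>1"
    and "C \<in> \<C>1"
    and "card (atoms_in \<K> C) \<ge> 2"
    and "A \<in> atoms_in \<K> C"
  shows "inv_weighted_norm_sq (atoms_in \<K> C) (stationary G \<K> C)
           (\<lambda>B. row_mult (atoms_in \<K> C) (point_mass A) (walk_matrix G \<K> C) B
                 - stationary G \<K> C B) \<le> 31"
proof -
  let ?I = "atoms_in \<K> C"
  let ?d = "atom_deg G \<K> C"
  define D where "D = (\<lambda>K. \<Sum>L\<in>?I - {K}. wt G K L)"
  have \<C>1: "clustering G \<C>1" and resp: "\<forall>K\<in>\<K>. \<exists>C\<in>\<C>1. K \<subseteq> C"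
    and R1: "\<And>S T. union_of_atoms \<K> S \<Longrightarrow> union_of_atoms \<K> T \<Longrightarrow> S \<noteq> {} \<Longrightarrow> T \<noteq> {} \<Longrightarrow>
               S \<union> T = C \<Longrightarrow> S \<inter> T = {} \<Longrightarrow> wt_pos G S T > 1 / 2 * wt G S T"
    using assms(9,10) unfolding regular_clustering_def by blast+
  have part: "partition_on (verts G) \<K>"
    using assms(4,5) partition_on_atom_partition unfolding base_clustering_def by blast
  have V: "finite (verts G)"
    using assms(1) unfolding cc_instance_def by blast
  have sub: "K \<subseteq> verts G" if "K \<in> ?I" for K
    using that partition_onD1[OF part] by (auto simp: atoms_in_def)
  have fin: "finite K" if "K \<in> ?I" for K
    using sub[OF that] V finite_subset by blast
  have ne: "K \<noteq> {}" if "K \<in> ?I" for K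
    using that partition_onD3[OF part] by (auto simp: atoms_in_def)
  have finI: "finite ?I"
    using assms(11) card.infinite by fastforce
  have disj: "disjoint ?I"
    using partition_onD2[OF part] by (auto simp: atoms_in_def disjoint_def)
  have CU: "\<Union>?I = C"
    using Union_atoms_in[OF part \<C>1 resp assms(10)] .

  have half: "D K < 2 * ?d K" if K: "K \<in> ?I" for K
  proof -
    let ?T = "\<Union>(?I - {K})"
    \<comment> \<open>(R1) requires both sides of the cut to be nonempty; this is where two atoms in
      \<open>C\<close> are needed.\<close>
    have "?I - {K} \<noteq> {}"
    proof
      assume "?I - {K} = {}"
      then have "card ?I \<le> card {K}"
        by (intro card_mono) auto
      then show False
        using assms(11) by simp
    qed
    then have "?T \<noteq> {}"
      using ne by blast
    moreover have "K \<union> ?T = C"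
      using CU K by blast
    moreover have "K \<inter> ?T = {}"
      using disj K by (auto simp: disjoint_def)
    moreover have "union_of_atoms \<K> K"
      unfolding union_of_atoms_def using K by (intro exI[of _ "{K}"]) (auto simp: atoms_in_def)
    moreover have "union_of_atoms \<K> ?T"
      unfolding union_of_atoms_def by (intro exI[of _ "?I - {K}"]) (auto simp: atoms_in_def)
    ultimately have "wt_pos G K ?T > 1 / 2 * wt G K ?T"
      using ne[OF K] by (intro R1) auto
    moreover have "disjoint (?I - {K})"
      using disj by (auto simp: disjoint_def)
    then have "wt G K ?T = D K" "wt_pos G K ?T = ?d K"
      using wt_Union_right[of "?I - {K}"] wt_pos_Union_right[of "?I - {K}"] finI fin
      by (auto simp: D_def atom_deg_def)
    ultimately show ?thesis
      by simp
  qed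
  have D0: "0 \<le> D K" if "K \<in> ?I" for K
    unfolding D_def using that sub assms(1) by (intro sum_nonneg wt_nonneg) auto
  \<comment> \<open>The strictness in (R1) gives positive degree even if \<open>D K\<close> is 0, so
    the divisions by degrees, volume and stationary masses are genuine.\<close>
  have d0: "0 < ?d K" if "K \<in> ?I" for K
    using half D0 that by fastforce
  have vol0: "0 < vol G \<K> C"
    unfolding vol_def using finI d0 assms(12) by (intro sum_pos) auto

  text \<open>With zero diagonal, the triangle inequality also holds for coinciding atoms.\<close>
  define W where "W = (\<lambda>K L. if K = L then 0 else wt G K L)"
  have DW: "(\<Sum>L\<in>?I. W K L) = D K" if "K \<in> ?I" for K
    unfolding D_def W_def using finI that by (subst sum.remove[of _ K]) (auto intro!: sum.cong split: if_splits)
  have "vol G \<K> C \<le> (\<Sum>K\<in>?I. D K)"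
    unfolding vol_def atom_deg_def D_def using sub assms(1)
    by (intro sum_mono wt_pos_le_wt) auto
  have product: "(\<Sum>K\<in>?I. D K) * W A B \<le> 4 * D A * D B" if B: "B \<in> ?I" for B
  proof -
    have "(\<Sum>K\<in>?I. \<Sum>L\<in>?I. W K L) * W A B \<le> 4 * (\<Sum>L\<in>?I. W A L) * (\<Sum>L\<in>?I. W B L)"
    proof (rule weighted_triangle_product_bound[where s = "\<lambda>K. real (card K)"])
      show "0 < real (card K)" if "K \<in> ?I" for K
        using that ne fin by (simp add: card_gt_0_iff)
      show "0 \<le> W K L" if "K \<in> ?I" "L \<in> ?I" for K L
        using that sub assms(1) by (simp add: W_def wt_nonneg)
      show "W K L = W L K" if "K \<in> ?I" "L \<in> ?I" for K L
        using that sub assms(1) by (simp add: W_def wt_commute)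
      \<comment> \<open>If \<open>K = L\<close>, the left side is 0. Otherwise, if \<open>X\<close>
        is \<open>K\<close> or \<open>L\<close>, one term on the right vanishes and the other equals
        the left side. For distinct atoms this is \<open>wt_triangle\<close>.\<close>
      show "W K L * real (card X) \<le> real (card L) * W K X + real (card K) * W X L"
        if "K \<in> ?I" "L \<in> ?I" "X \<in> ?I" for K L X
        using that sub assms(1) wt_triangle[of G K L X] wt_nonneg[of G K X] wt_nonneg[of G X L]
        by (auto simp: W_def)
    qed (use finI assms(12) B in auto)
    then show ?thesis
      using DW assms(12) B by simp
  qed

  let ?P = "walk_matrix G \<K> C A" and ?\<pi> = "stationary G \<K> C"
  have "?P B \<le> 16 * ?\<pi> B" if B: "B \<in> ?I" for B
  proof (cases "A = B")
    case True
    then show ?thesis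
      using d0[OF B] vol0 by (simp add: walk_matrix_def stationary_def)
  next
    case False
    have "vol G \<K> C * wt_pos G A B \<le> (\<Sum>K\<in>?I. D K) * W A B"
      using False sub assms(1,12) B \<open>vol G \<K> C \<le> _\<close> vol0
      by (intro mult_mono) (auto simp: W_def wt_pos_le_wt wt_pos_nonneg D0 sum_nonneg)
    also have "\<dots> \<le> 4 * (D A * D B)"
      using product[OF B] by simp
    \<comment> \<open>Passing from all weight to positive weight costs a factor 2 for each of
      \<open>A\<close> and \<open>B\<close>, which turns 4 into 16.\<close>
    also have "\<dots> \<le> 4 * ((2 * ?d A) * (2 * ?d B))"
      using half[OF assms(12)] half[OF B] D0[OF assms(12)] D0[OF B]
      by (intro mult_left_mono mult_mono) auto
    finally have "vol G \<K> C * wt_pos G A B \<le> 16 * ?d A * ?d B"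
      by simp
    then show ?thesis
      using False d0[OF assms(12)] vol0 by (simp add: walk_matrix_def stationary_def field_simps)
  qed
  moreover have "sum ?P ?I = 1"
  proof -
    have "sum ?P ?I = (\<Sum>B\<in>?I - {A}. wt_pos G A B / ?d A)"
      using finI assms(12) by (subst sum.remove[of _ A]) (auto simp: walk_matrix_def intro!: sum.cong split: if_splits)
    also have "\<dots> = ?d A / ?d A"
      by (subst (2) atom_deg_def) (simp add: sum_divide_distrib)
    finally show ?thesis
      using d0[OF assms(12)] by simp
  qed
  moreover have "sum ?\<pi> ?I = 1"
    using vol0 by (simp add: stationary_def vol_def flip: sum_divide_distrib)
  moreover have "0 \<le> ?P B" if "B \<in> ?I" for B
    using that d0[OF assms(12)] sub assms(1,12) by (auto simp: walk_matrix_def wt_pos_nonneg)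
  moreover have "0 < ?\<pi> B" if "B \<in> ?I" for B
    using that d0 vol0 by (simp add: stationary_def)
  \<comment> \<open>With c = 16 the bound is 15, which lies below the claimed 31.\<close>
  ultimately have "inv_weighted_norm_sq ?I ?\<pi> (\<lambda>B. ?P B - ?\<pi> B) \<le> 16 - 1"
    using finI by (intro chi_square_le) auto
  \<comment> \<open>The point mass selects row \<open>A\<close> of the matrix.\<close>
  moreover have "row_mult ?I (point_mass A) (walk_matrix G \<K> C) B = ?P B" for B
    using finI assms(12) by (simp add: row_mult_def point_mass_def if_distrib[of "\<lambda>c. c * _"] cong: if_cong)
  ultimately show ?thesis
    by simp
qed

end
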